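(* Let $\mathbb P$ be the linear species of finite (nonempty) posets. The partial compositions $\circ_a$ (defined in the context) endow $\mathbb P$ with a linear operad structure, and this operad is isomorphic to the operad $(\mathbb P,\bullet)$ given by the partial compositions $\bullet_a$ (defined in the context).
   Context: Fix a field $\mathbf k$. $\mathbb P_A$ is the $\mathbf k$-vector space freely generated by all partial orders on the finite nonempty set $A$; bijections act by relabelling. For disjoint $A,B$ and $a\in A$ put $A\sqcup_a B:=(A\setminus\{a\})\sqcup B$. Definition of $\bullet_a$: for posets $\mathcal A=(A,\le_A)$, $\mathcal B=(B,\le_B)$, $\mathcal A\bullet_a\mathcal B$ is $A\sqcup_a B$ with $x\le y$ iff ($x,y\in B$, $x\le_By$) or ($x,y\in A\setminus\{a\}$, $x\le_Ay$) or ($x\in A\setminus\{a\}$, $y\in B$, $x\le_Aa$) or ($x\in B$, $y\in A\setminus\{a\}$, $a\le_Ay$); extended bilinearly. Definition of $\circ_a$: a subset $B$ of a poset $(P,\le)$ is convex if $x,y\in B$, $x\le z\le y$ imply $z\in B$. For a nonempty convex $B$, the quotient poset $(P,\le)/B$ is the set $(P\setminus B)\sqcup\{B\}$ with the partial order $\leqslant$: $\{B\}\leqslant\{B\}$; for $y\in P\setminus B$, $\{B\}\leqslant y$ iff $b\le y$ for some $b\in B$; for $x\in P\setminus B$, $x\leqslant\{B\}$ iff $x\le b$ for some $b\in B$; for $x,y\in P\setminus B$, $x\leqslant y$ iff $x\le y$ or there exist $b,b'\in B$ with $x\le b$, $b'\le y$. Let $\Omega(\mathcal A,a,\mathcal B)$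 be the set of partial orders $\le$ on $A\sqcup_aB$ such that $\le$ restricted to $B$ is $\le_B$, $B$ is convex in $(A\sqcup_aB,\le)$, and $(A\sqcup_aB,\le)/B$ equals $\mathcal A$ when the point $\{B\}$ is identified with $a$. Then $\mathcal A\circ_a\mathcal B:=\sum_{\le\in\Omega(\mathcal A,a,\mathcal B)}(A\sqcup_aB,\le)$, extended bilinearly. A linear operad structure on a linear species, via partial compositions $\star_a:\mathbb P_A\otimes\mathbb P_B\to\mathbb P_{A\sqcup_aB}$, means: naturality under relabelling; $(X\star_aY)\star_{a'}Z=(X\star_{a'}Z)\star_aY$ for $a\neq a'\in A$; $(X\star_aY)\star_bZ=X\star_a(Y\star_bZ)$ for $a\in A$, $b\in B$; and units (here the one-point posets). An isomorphism of operads is a species isomorphism commuting with the partial compositions (and preserving units). *)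

theory Defs
  imports Complex_Main "HOL-Library.Poly_Mapping"
begin

section \<open>Linear species and linear operads\<close>

text \<open>
  Species are evaluated on the finite nonempty subsets of an arbitrary type. All the spaces
  \<open>S A\<close> of a linear species live in one ambient vector space, as subspaces; a function
  \<open>\<sigma>\<close> on the whole type represents the bijection that it restricts to.
\<close>

abbreviation finite_nonempty :: "'a set \<Rightarrow> bool" where
  "finite_nonempty A \<equiv> finite A \<and> A \<noteq> {}"

definition linear_map_on ::
  "('k \<Rightarrow> 'v \<Rightarrow> 'v::ab_group_add) \<Rightarrow> ('k \<Rightarrow> 'w \<Rightarrow> 'w::ab_group_add) \<Rightarrow>
   'v set \<Rightarrow> 'w set \<Rightarrow> ('v \<Rightarrow> 'w) \<Rightarrow> bool" where
  "linear_map_on scale1 scale2 U W f \<longleftrightarrow>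
     (\<forall>u\<in>U. f u \<in> W) \<and>
     (\<forall>u\<in>U. \<forall>v\<in>U. f (u + v) = f u + f v) \<and>
     (\<forall>c. \<forall>u\<in>U. f (scale1 c u) = scale2 c (f u))"

locale linear_species = vector_space scale
  for scale :: "'k::field \<Rightarrow> 'v::ab_group_add \<Rightarrow> 'v"
    and S :: "'a set \<Rightarrow> 'v set"
    and act :: "'a set \<Rightarrow> ('a \<Rightarrow> 'a) \<Rightarrow> 'v \<Rightarrow> 'v" +
  assumes subspace_S: "finite_nonempty A \<Longrightarrow> subspace (S A)"
    and act_linear: "\<lbrakk>finite_nonempty A; bij_betw \<sigma> A B\<rbrakk> \<Longrightarrow>
          linear_map_on scale scale (S A) (S B) (act A \<sigma>)"
    and act_cong: "\<lbrakk>finite_nonempty A; \<And>x. x \<in> A \<Longrightarrow> \<sigma> x = \<tau> x; bij_betw \<sigma> A B; X \<in> S A\<rbrakk> \<Longrightarrow>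
          act A \<sigma> X = act A \<tau> X"
    and act_id: "\<lbrakk>finite_nonempty A; X \<in> S A\<rbrakk> \<Longrightarrow> act A id X = X"
    and act_comp: "\<lbrakk>finite_nonempty A; bij_betw \<sigma> A B; bij_betw \<tau> B C; X \<in> S A\<rbrakk> \<Longrightarrow>
          act A (\<tau> \<circ> \<sigma>) X = act B \<tau> (act A \<sigma> X)"

definition insert_at :: "'a set \<Rightarrow> 'a \<Rightarrow> 'a set \<Rightarrow> 'a set" where
  "insert_at A a B = (A - {a}) \<union> B"

text \<open>
  \<open>comp A a B X Y\<close> is the partial composite of \<open>X \<in> S A\<close> and \<open>Y \<in> S B\<close> at \<open>a \<in> A\<close>, for disjoint
  \<open>A\<close> and \<open>B\<close>. Its bilinearity makes it a linear map on the tensor product of \<open>S A\<close> and \<open>S B\<close>.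
  In \<open>unit_right\<close> the composite lies over the set obtained from \<open>A\<close> by renaming \<open>a\<close> to \<open>b\<close>.
\<close>

locale linear_operad = linear_species scale S act
  for scale :: "'k::field \<Rightarrow> 'v::ab_group_add \<Rightarrow> 'v"
    and S :: "'a set \<Rightarrow> 'v set"
    and act :: "'a set \<Rightarrow> ('a \<Rightarrow> 'a) \<Rightarrow> 'v \<Rightarrow> 'v" +
  fixes comp :: "'a set \<Rightarrow> 'a \<Rightarrow> 'a set \<Rightarrow> 'v \<Rightarrow> 'v \<Rightarrow> 'v"
    and unit :: "'a \<Rightarrow> 'v"
  assumes comp_linear_left:
      "\<lbrakk>finite_nonempty A; finite_nonempty B; A \<inter> B = {}; a \<in> A; Y \<in> S B\<rbrakk> \<Longrightarrow>
       linear_map_on scale scale (S A) (S (insert_at A a B)) (\<lambda>X. comp A a B X Y)"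
    and comp_linear_right:
      "\<lbrakk>finite_nonempty A; finite_nonempty B; A \<inter> B = {}; a \<in> A; X \<in> S A\<rbrakk> \<Longrightarrow>
       linear_map_on scale scale (S B) (S (insert_at A a B)) (\<lambda>Y. comp A a B X Y)"
    and comp_natural:
      "\<lbrakk>finite_nonempty A; finite_nonempty B; A \<inter> B = {}; a \<in> A;
        bij_betw \<sigma> A A'; bij_betw \<tau> B B'; A' \<inter> B' = {}; X \<in> S A; Y \<in> S B\<rbrakk> \<Longrightarrow>
       act (insert_at A a B) (\<lambda>x. if x \<in> B then \<tau> x else \<sigma> x) (comp A a B X Y) =
       comp A' (\<sigma> a) B' (act A \<sigma> X) (act B \<tau> Y)"
    and comp_parallel:
      "\<lbrakk>finite_nonempty A; finite_nonempty B; finite_nonempty C;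
        A \<inter> B = {}; A \<inter> C = {}; B \<inter> C = {}; a \<in> A; a' \<in> A; a \<noteq> a';
        X \<in> S A; Y \<in> S B; Z \<in> S C\<rbrakk> \<Longrightarrow>
       comp (insert_at A a B) a' C (comp A a B X Y) Z =
       comp (insert_at A a' C) a B (comp A a' C X Z) Y"
    and comp_nested:
      "\<lbrakk>finite_nonempty A; finite_nonempty B; finite_nonempty C;
        A \<inter> B = {}; A \<inter> C = {}; B \<inter> C = {}; a \<in> A; b \<in> B;
        X \<in> S A; Y \<in> S B; Z \<in> S C\<rbrakk> \<Longrightarrow>
       comp (insert_at A a B) b C (comp A a B X Y) Z =
       comp A a (insert_at B b C) X (comp B b C Y Z)"
    and unit_in: "unit a \<in> S {a}"
    and unit_natural: "act {a} \<sigma> (unit a) = unit (\<sigma> a)"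
    and unit_left:
      "\<lbrakk>finite_nonempty B; a \<notin> B; Y \<in> S B\<rbrakk> \<Longrightarrow> comp {a} a B (unit a) Y = Y"
    and unit_right:
      "\<lbrakk>finite_nonempty A; a \<in> A; b \<notin> A; X \<in> S A\<rbrakk> \<Longrightarrow>
       comp A a {b} X (unit b) = act A (id(a := b)) X"

locale linear_operad_iso =
  source: linear_operad scale1 S1 act1 comp1 unit1 +
  target: linear_operad scale2 S2 act2 comp2 unit2
  for scale1 :: "'k::field \<Rightarrow> 'v::ab_group_add \<Rightarrow> 'v"
    and S1 :: "'a set \<Rightarrow> 'v set"
    and act1 comp1 unit1
    and scale2 :: "'k::field \<Rightarrow> 'w::ab_group_add \<Rightarrow> 'w"
    and S2 :: "'a set \<Rightarrow> 'w set"
    and act2 comp2 unit2 +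
  fixes \<theta> :: "'a set \<Rightarrow> 'v \<Rightarrow> 'w"
  assumes iso_linear: "finite_nonempty A \<Longrightarrow> linear_map_on scale1 scale2 (S1 A) (S2 A) (\<theta> A)"
    and iso_bij: "finite_nonempty A \<Longrightarrow> bij_betw (\<theta> A) (S1 A) (S2 A)"
    and iso_natural: "\<lbrakk>finite_nonempty A; bij_betw \<sigma> A B; X \<in> S1 A\<rbrakk> \<Longrightarrow>
          \<theta> B (act1 A \<sigma> X) = act2 A \<sigma> (\<theta> A X)"
    and iso_comp:
      "\<lbrakk>finite_nonempty A; finite_nonempty B; A \<inter> B = {}; a \<in> A; X \<in> S1 A; Y \<in> S1 B\<rbrakk> \<Longrightarrow>
       \<theta> (insert_at A a B) (comp1 A a B X Y) = comp2 A a B (\<theta> A X) (\<theta> B Y)"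
    and iso_unit: "\<theta> {a} (unit1 a) = unit2 a"


section \<open>The linear species of finite posets\<close>

text \<open>
  A poset on \<open>A\<close> is given by its order relation \<open>r \<subseteq> A \<times> A\<close>, where \<open>(x, y) \<in> r\<close> means \<open>x \<le> y\<close>. The
  ambient vector space is freely generated by all relations on the type.
\<close>

definition fscale :: "'k::field \<Rightarrow> ('b \<Rightarrow>\<^sub>0 'k) \<Rightarrow> ('b \<Rightarrow>\<^sub>0 'k)" where
  "fscale c = Poly_Mapping.map (\<lambda>x. c * x)"

definition basis_vec :: "'b \<Rightarrow> ('b \<Rightarrow>\<^sub>0 'k::field)" where
  "basis_vec r = Poly_Mapping.single r 1"

definition linear_ext :: "('b \<Rightarrow> ('c \<Rightarrow>\<^sub>0 'k::field)) \<Rightarrow> ('b \<Rightarrow>\<^sub>0 'k) \<Rightarrow> ('c \<Rightarrow>\<^sub>0 'k)" where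
  "linear_ext f X =
     (\<Sum>r\<in>Poly_Mapping.keys X. fscale (Poly_Mapping.lookup X r) (f r))"

definition bilinear_ext ::
  "('b \<Rightarrow> 'c \<Rightarrow> ('d \<Rightarrow>\<^sub>0 'k::field)) \<Rightarrow> ('b \<Rightarrow>\<^sub>0 'k) \<Rightarrow> ('c \<Rightarrow>\<^sub>0 'k) \<Rightarrow> ('d \<Rightarrow>\<^sub>0 'k)" where
  "bilinear_ext f X Y = linear_ext (\<lambda>r. linear_ext (f r) Y) X"

definition poset_space :: "'a set \<Rightarrow> ('a rel \<Rightarrow>\<^sub>0 'k::field) set" where
  "poset_space A = {X. \<forall>r\<in>Poly_Mapping.keys X. partial_order_on A r}"

definition poset_act :: "'a set \<Rightarrow> ('a \<Rightarrow> 'a) \<Rightarrow> ('a rel \<Rightarrow>\<^sub>0 'k::field) \<Rightarrow> ('a rel \<Rightarrow>\<^sub>0 'k)" where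
  "poset_act A \<sigma> = linear_ext (\<lambda>r. basis_vec (map_prod \<sigma> \<sigma> ` r))"

definition poset_unit :: "'a \<Rightarrow> ('a rel \<Rightarrow>\<^sub>0 'k::field)" where
  "poset_unit a = basis_vec {(a, a)}"


section \<open>The two families of partial compositions\<close>

definition bullet_order :: "'a set \<Rightarrow> 'a \<Rightarrow> 'a set \<Rightarrow> 'a rel \<Rightarrow> 'a rel \<Rightarrow> 'a rel" where
  "bullet_order A a B r s =
     {(x, y). (x \<in> B \<and> y \<in> B \<and> (x, y) \<in> s) \<or>
              (x \<in> A - {a} \<and> y \<in> A - {a} \<and> (x, y) \<in> r) \<or>
              (x \<in> A - {a} \<and> y \<in> B \<and> (x, a) \<in> r) \<or>
              (x \<in> B \<and> y \<in> A - {a} \<and> (a, y) \<in> r)}"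

definition bullet_comp ::
  "'a set \<Rightarrow> 'a \<Rightarrow> 'a set \<Rightarrow> ('a rel \<Rightarrow>\<^sub>0 'k::field) \<Rightarrow> ('a rel \<Rightarrow>\<^sub>0 'k) \<Rightarrow> ('a rel \<Rightarrow>\<^sub>0 'k)" where
  "bullet_comp A a B = bilinear_ext (\<lambda>r s. basis_vec (bullet_order A a B r s))"

definition convex_in :: "'a set \<Rightarrow> 'a rel \<Rightarrow> 'a set \<Rightarrow> bool" where
  "convex_in P r B \<longleftrightarrow>
     B \<subseteq> P \<and> (\<forall>x\<in>B. \<forall>y\<in>B. \<forall>z\<in>P. (x, z) \<in> r \<and> (z, y) \<in> r \<longrightarrow> z \<in> B)"

text \<open>
  The order of the quotient poset \<open>(P, r) / B\<close>, with the collapsed point \<open>{B}\<close> named \<open>p\<close>; the name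
  has to satisfy \<open>p \<notin> P - B\<close>.
\<close>

definition quotient_order :: "'a set \<Rightarrow> 'a rel \<Rightarrow> 'a set \<Rightarrow> 'a \<Rightarrow> 'a rel" where
  "quotient_order P r B p =
     {(p, p)} \<union>
     {(p, y) | y. y \<in> P - B \<and> (\<exists>b\<in>B. (b, y) \<in> r)} \<union>
     {(x, p) | x. x \<in> P - B \<and> (\<exists>b\<in>B. (x, b) \<in> r)} \<union>
     {(x, y) | x y. x \<in> P - B \<and> y \<in> P - B \<and>
        ((x, y) \<in> r \<or> (\<exists>b\<in>B. \<exists>b'\<in>B. (x, b) \<in> r \<and> (b', y) \<in> r))}"

definition Omega :: "'a set \<Rightarrow> 'a \<Rightarrow> 'a set \<Rightarrow> 'a rel \<Rightarrow> 'a rel \<Rightarrow> 'a rel set" where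
  "Omega A a B r s =
     {t. partial_order_on (insert_at A a B) t \<and>
         t \<inter> B \<times> B = s \<and>
         convex_in (insert_at A a B) t B \<and>
         quotient_order (insert_at A a B) t B a = r}"

definition circ_comp ::
  "'a set \<Rightarrow> 'a \<Rightarrow> 'a set \<Rightarrow> ('a rel \<Rightarrow>\<^sub>0 'k::field) \<Rightarrow> ('a rel \<Rightarrow>\<^sub>0 'k) \<Rightarrow> ('a rel \<Rightarrow>\<^sub>0 'k)" where
  "circ_comp A a B = bilinear_ext (\<lambda>r s. \<Sum>t\<in>Omega A a B r s. basis_vec t)"

end

(*
The sum psi(r) of all partial orders on A contained in the order r defines a unitriangular, hence
invertible, natural endomorphism of the species. An order t is contained in the order r bullet_a s iff B is
convex in t, the quotient t/B is contained in r and the restriction of t to B is contained in s;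
that is, iff t belongs to Omega(r', s') for some r' contained in r and s' contained in s, which t
determines. So psi carries the compositions bullet to the compositions circ, and the operad axioms, which
are direct to check for bullet, are transported along psi.
*)
theory Submission
  imports Defs
begin

text \<open>A direct check of the axioms for \<open>circ_comp\<close> would have to match iterated
  sums over \<open>Omega\<close>. A bullet composite of two posets is a single poset, so each axiom
  for \<open>bullet_comp\<close> becomes one identity between relations. The map psi arises by
  relaxing \<open>Omega\<close>: there the quotient and the restriction of t are prescribed exactly,
  and summing over all smaller prescriptions leaves two inclusions, into r and into s. Among the
  orders satisfying them there is a largest one, the bullet composite. Convexity need not be imposed
  after the relaxation: a point strictly between two points of B would lie both above and below a in
  r, against antisymmetry. The matrix of psi has entries 0 and 1 and ones on the diagonal, so the
  characteristic of the field is irrelevant. No formula for the inverse is used: injectivity is read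
  off an inclusion-maximal order in the support, surjectivity comes by induction on the order. As
  psi goes from bullet to circ, the isomorphism asked for is its inverse.\<close>

lemma linear_map_on_in:
  assumes "linear_map_on s1 s2 U W f" "u \<in> U" shows "f u \<in> W"
  using assms by (simp add: linear_map_on_def)

section \<open>Free vector spaces\<close>

lemma lookup_fscale [simp]: "Poly_Mapping.lookup (fscale c X) r = c * Poly_Mapping.lookup X r"
  by (simp add: fscale_def map.rep_eq when_def)

interpretation fs: vector_space "fscale :: 'k::field \<Rightarrow> ('b \<Rightarrow>\<^sub>0 'k) \<Rightarrow> ('b \<Rightarrow>\<^sub>0 'k)"
  by unfold_locales (auto intro!: poly_mapping_eqI simp: lookup_add algebra_simps)

text \<open>Linearity is taken on the whole ambient space, not only on \<open>poset_space A\<close>.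
  All maps here are linear extensions, so they compose without side conditions; membership in
  \<open>poset_space\<close> is tracked separately.\<close>

abbreviation flinear :: "(('b \<Rightarrow>\<^sub>0 'k::field) \<Rightarrow> ('c \<Rightarrow>\<^sub>0 'k)) \<Rightarrow> bool" where
  "flinear \<equiv> Vector_Spaces.linear fscale fscale"

lemma flinear_iff:
  "flinear f \<longleftrightarrow> (\<forall>X Y. f (X + Y) = f X + f Y) \<and> (\<forall>c X. f (fscale c X) = fscale c (f X))"
  by (auto simp: Vector_Spaces.linear_iff fs.vector_space_axioms)

lemma flinear_compose: "flinear f \<Longrightarrow> flinear g \<Longrightarrow> flinear (\<lambda>X. g (f X))"
  by (simp add: flinear_iff)

lemma flinear_sum: "flinear f \<Longrightarrow> f (sum g I) = (\<Sum>i\<in>I. f (g i))"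
  by (rule module_hom.sum[of fscale fscale]) (simp add: Vector_Spaces.linear_def)

lemma basis_expansion:
  "(\<Sum>r\<in>Poly_Mapping.keys X. fscale (Poly_Mapping.lookup X r) (basis_vec r)) = X"
  by (rule poly_mapping_eqI)
     (simp add: lookup_sum basis_vec_def lookup_single when_def in_keys_iff if_distrib cong: if_cong)

text \<open>Coefficients can cancel, so the supports of X, Y and X + Y differ. A common finite index
  set makes additivity a termwise statement.\<close>

lemma linear_ext_superset:
  assumes "finite K" "Poly_Mapping.keys X \<subseteq> K"
  shows "linear_ext f X = (\<Sum>r\<in>K. fscale (Poly_Mapping.lookup X r) (f r))"
  unfolding linear_ext_def
  by (rule sum.mono_neutral_left) (use assms in \<open>auto simp: in_keys_iff\<close>)

lemma flinear_linear_ext: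
  fixes f :: "'b \<Rightarrow> 'c \<Rightarrow>\<^sub>0 'k::field"
  shows "flinear (linear_ext f)"
  unfolding flinear_iff
proof (intro conjI allI)
  fix X Y :: "'b \<Rightarrow>\<^sub>0 'k"
  let ?K = "Poly_Mapping.keys X \<union> Poly_Mapping.keys Y"
  have "linear_ext f Z = (\<Sum>r\<in>?K. fscale (Poly_Mapping.lookup Z r) (f r))"
    if "Z \<in> {X, Y, X + Y}" for Z
    by (rule linear_ext_superset) (use that keys_add[of X Y] in auto)
  then show "linear_ext f (X + Y) = linear_ext f X + linear_ext f Y"
    by (simp add: lookup_add fs.scale_left_distrib sum.distrib)
next
  fix c and X :: "'b \<Rightarrow>\<^sub>0 'k"
  have "linear_ext f (fscale c X) =
      (\<Sum>r\<in>Poly_Mapping.keys X. fscale (Poly_Mapping.lookup (fscale c X) r) (f r))"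
    by (rule linear_ext_superset) (auto simp: in_keys_iff)
  then show "linear_ext f (fscale c X) = fscale c (linear_ext f X)"
    by (simp add: linear_ext_def fs.scale_sum_right)
qed

lemma linear_ext_basis [simp]: "linear_ext f (basis_vec r) = f r"
  by (simp add: linear_ext_def basis_vec_def)

lemma bilinear_ext_basis [simp]: "bilinear_ext f (basis_vec r) (basis_vec s) = f r s"
  by (simp add: bilinear_ext_def)

lemma flinear_bilinear_ext_left: "flinear (\<lambda>X. bilinear_ext f X Y)"
  unfolding bilinear_ext_def by (rule flinear_linear_ext)

text \<open>The outer sum of \<open>bilinear_ext\<close> runs over the support of X, which stays
  fixed while the second argument varies. Linearity is therefore checked term by term, and scalars
  move past the coefficients of X by commutativity of the field.\<close>

lemma flinear_bilinear_ext_right: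
  fixes f :: "'b \<Rightarrow> 'c \<Rightarrow> 'd \<Rightarrow>\<^sub>0 'k::field"
  shows "flinear (bilinear_ext f X)"
proof -
  have "linear_ext g (X + Y) = linear_ext g X + linear_ext g Y"
    "linear_ext g (fscale c X) = fscale c (linear_ext g X)"
    for g :: "'c \<Rightarrow> 'd \<Rightarrow>\<^sub>0 'k" and c X Y
    using flinear_linear_ext[of g] by (simp_all add: flinear_iff)
  then show ?thesis
    by (simp add: flinear_iff bilinear_ext_def linear_ext_def[of _ X] fs.scale_right_distrib
        sum.distrib fs.scale_sum_right mult.commute)
qed

section \<open>The species of posets\<close>

lemma subspace_poset_space:
  "fs.subspace (poset_space A :: ('a rel \<Rightarrow>\<^sub>0 'k::field) set)"
proof (rule fs.subspaceI)
  fix X Y :: "'a rel \<Rightarrow>\<^sub>0 'k"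
  assume "X \<in> poset_space A" "Y \<in> poset_space A"
  then show "X + Y \<in> poset_space A"
    using keys_add[of X Y] by (auto simp: poset_space_def)
qed (auto simp: poset_space_def in_keys_iff)

lemma basis_vec_in_poset_space [simp]:
  "(basis_vec r :: 'a rel \<Rightarrow>\<^sub>0 'k::field) \<in> poset_space A \<longleftrightarrow> partial_order_on A r"
  by (simp add: basis_vec_def poset_space_def)

section \<open>Reduction of multilinear identities to basis posets\<close>

lemma flinear_basis_expansion:
  assumes "flinear f"
  shows "f X = (\<Sum>r\<in>Poly_Mapping.keys X. fscale (Poly_Mapping.lookup X r) (f (basis_vec r)))"
  using flinear_sum[OF assms, of "\<lambda>r. fscale (Poly_Mapping.lookup X r) (basis_vec r)"
      "Poly_Mapping.keys X"] assms
  by (simp add: basis_expansion flinear_iff)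

text \<open>Only partial orders occur in the support of X. Agreement on these basis vectors is what
  can be expected: naturality or the unit laws may fail for arbitrary relations. The versions for
  two and three arguments below free one argument at a time.\<close>

lemma flinear_eqI:
  assumes "flinear f" "flinear g" "X \<in> poset_space A"
    and "\<And>r. partial_order_on A r \<Longrightarrow> f (basis_vec r) = g (basis_vec r)"
  shows "f X = g X"
  unfolding flinear_basis_expansion[OF assms(1), of X] flinear_basis_expansion[OF assms(2), of X]
  by (rule sum.cong) (use assms(3,4) in \<open>auto simp: poset_space_def\<close>)

lemma flinear_eqI2:
  assumes "\<And>Y. flinear (\<lambda>X. f X Y)" "\<And>X. flinear (f X)"
    and "\<And>Y. flinear (\<lambda>X. g X Y)" "\<And>X. flinear (g X)"
    and "X \<in> poset_space A" "Y \<in> poset_space B"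
    and "\<And>r s. partial_order_on A r \<Longrightarrow> partial_order_on B s \<Longrightarrow>
      f (basis_vec r) (basis_vec s) = g (basis_vec r) (basis_vec s)"
  shows "f X Y = g X Y"
  by (rule flinear_eqI[OF assms(1,3,5)], rule flinear_eqI[OF assms(2,4,6)], rule assms(7))

lemma flinear_eqI3:
  assumes "\<And>Y Z. flinear (\<lambda>X. f X Y Z)" "\<And>X Z. flinear (\<lambda>Y. f X Y Z)" "\<And>X Y. flinear (f X Y)"
    and "\<And>Y Z. flinear (\<lambda>X. g X Y Z)" "\<And>X Z. flinear (\<lambda>Y. g X Y Z)" "\<And>X Y. flinear (g X Y)"
    and "X \<in> poset_space A" "Y \<in> poset_space B" "Z \<in> poset_space C"
    and "\<And>r s t. partial_order_on A r \<Longrightarrow> partial_order_on B s \<Longrightarrow> partial_order_on C t \<Longrightarrow>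
      f (basis_vec r) (basis_vec s) (basis_vec t) = g (basis_vec r) (basis_vec s) (basis_vec t)"
  shows "f X Y Z = g X Y Z"
  by (rule flinear_eqI[OF assms(1,4,7)], rule flinear_eqI2[OF assms(2,3,5,6,8,9)], rule assms(10))

lemma flinear_in_poset_space:
  assumes "flinear f" "X \<in> poset_space A"
    and "\<And>r. partial_order_on A r \<Longrightarrow> f (basis_vec r) \<in> poset_space B"
  shows "f X \<in> poset_space B"
  unfolding flinear_basis_expansion[OF assms(1), of X]
  by (intro fs.subspace_sum fs.subspace_scale subspace_poset_space)
     (use assms(2,3) in \<open>auto simp: poset_space_def\<close>)

lemma linear_map_on_flinear:
  "flinear f \<Longrightarrow> (\<And>X. X \<in> U \<Longrightarrow> f X \<in> W) \<Longrightarrow> linear_map_on fscale fscale U W f"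
  by (simp add: linear_map_on_def flinear_iff)

section \<open>Relabelling of posets\<close>

lemma flinear_poset_act: "flinear (poset_act A \<sigma>)"
  unfolding poset_act_def by (rule flinear_linear_ext)

lemma poset_act_basis [simp]: "poset_act A \<sigma> (basis_vec r) = basis_vec (map_prod \<sigma> \<sigma> ` r)"
  by (simp add: poset_act_def)

lemma partial_order_on_iff:
  "partial_order_on A r \<longleftrightarrow> r \<subseteq> A \<times> A \<and> (\<forall>x\<in>A. (x, x) \<in> r) \<and>
    (\<forall>x y z. (x, y) \<in> r \<and> (y, z) \<in> r \<longrightarrow> (x, z) \<in> r) \<and>
    (\<forall>x y. (x, y) \<in> r \<and> (y, x) \<in> r \<longrightarrow> x = y)"
  unfolding partial_order_on_def preorder_on_def refl_on_def trans_def antisym_def imp_conjL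
    conj_assoc ..

lemma map_prod_image_mem_iff:
  assumes "inj_on \<sigma> A" "r \<subseteq> A \<times> A" "x \<in> A" "y \<in> A"
  shows "(\<sigma> x, \<sigma> y) \<in> map_prod \<sigma> \<sigma> ` r \<longleftrightarrow> (x, y) \<in> r"
  using inj_on_image_mem_iff[OF map_prod_inj_on[OF assms(1,1)], of "(x, y)" r] assms by simp

lemma partial_order_on_relabel:
  assumes "bij_betw \<sigma> A B" "partial_order_on A r"
  shows "partial_order_on B (map_prod \<sigma> \<sigma> ` r)"
proof -
  have inj: "inj_on \<sigma> A" and B: "B = \<sigma> ` A"
    using assms(1) by (auto simp: bij_betw_def)
  note rel = map_prod_image_mem_iff[OF inj partial_order_onD(4)[OF assms(2)]]
  have sub: "map_prod \<sigma> \<sigma> ` r \<subseteq> \<sigma> ` A \<times> \<sigma> ` A"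
    using partial_order_onD(4)[OF assms(2)] by auto
  show ?thesis
    unfolding partial_order_on_iff B
  proof (intro conjI allI impI)
    show "\<forall>x\<in>\<sigma> ` A. (x, x) \<in> map_prod \<sigma> \<sigma> ` r"
      using partial_order_onD(1)[OF assms(2)] by (simp add: rel refl_on_def)
    show "(x, z) \<in> map_prod \<sigma> \<sigma> ` r"
      if h: "(x, y) \<in> map_prod \<sigma> \<sigma> ` r \<and> (y, z) \<in> map_prod \<sigma> \<sigma> ` r" for x y z
    proof -
      obtain x' y' z' where "x' \<in> A" "y' \<in> A" "z' \<in> A" "x = \<sigma> x'" "y = \<sigma> y'" "z = \<sigma> z'"
        using subsetD[OF sub conjunct1[OF h]] subsetD[OF sub conjunct2[OF h]]
        by (elim SigmaE2 imageE)
      then show ?thesis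
        using h transD[OF partial_order_onD(2)[OF assms(2)], of x' y' z'] by (simp add: rel)
    qed
    show "x = y" if h: "(x, y) \<in> map_prod \<sigma> \<sigma> ` r \<and> (y, x) \<in> map_prod \<sigma> \<sigma> ` r" for x y
    proof -
      obtain x' y' where "x' \<in> A" "y' \<in> A" "x = \<sigma> x'" "y = \<sigma> y'"
        using subsetD[OF sub conjunct1[OF h]] by (elim SigmaE2 imageE)
      then show ?thesis
        using h antisymD[OF partial_order_onD(3)[OF assms(2)], of x' y'] by (simp add: rel)
    qed
  qed (rule sub)
qed

lemma linear_species_poset:
  "linear_species (fscale :: 'k::field \<Rightarrow> ('a rel \<Rightarrow>\<^sub>0 'k) \<Rightarrow> _) poset_space poset_act"
proof (unfold_locales, goal_cases)
  case (1 A)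
  show ?case by (rule subspace_poset_space)
next
  case (2 A \<sigma> B)
  show ?case
    by (intro linear_map_on_flinear flinear_poset_act, erule flinear_in_poset_space[OF flinear_poset_act])
       (use partial_order_on_relabel[OF \<open>bij_betw \<sigma> A B\<close>] in simp)
next
  case (3 A \<sigma> \<tau> B X)
  show ?case
  proof (rule flinear_eqI[OF flinear_poset_act flinear_poset_act \<open>X \<in> _\<close>])
    fix r assume "partial_order_on A r"
    have "map_prod \<sigma> \<sigma> ` r = map_prod \<tau> \<tau> ` r"
      using 3(2) partial_order_onD(4)[OF \<open>partial_order_on A r\<close>]
      by (intro image_cong refl) (auto simp: map_prod_def)
    then show "poset_act A \<sigma> (basis_vec r :: 'a rel \<Rightarrow>\<^sub>0 'k) = poset_act A \<tau> (basis_vec r)"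
      by simp
  qed
next
  case (4 A X)
  show ?case
    by (rule flinear_eqI[OF flinear_poset_act fs.linear_ident \<open>X \<in> _\<close>]) (simp add: map_prod.id)
next
  case (5 A \<sigma> B \<tau> C X)
  have lin: "flinear (\<lambda>X. poset_act B \<tau> (poset_act A \<sigma> X) :: 'a rel \<Rightarrow>\<^sub>0 'k)"
    by (rule flinear_compose[OF flinear_poset_act flinear_poset_act])
  show ?case
  proof (rule flinear_eqI[OF flinear_poset_act lin \<open>X \<in> _\<close>])
    fix r
    show "poset_act A (\<tau> \<circ> \<sigma>) (basis_vec r) =
        poset_act B \<tau> (poset_act A \<sigma> (basis_vec r) :: 'a rel \<Rightarrow>\<^sub>0 'k)"
      by (simp only: poset_act_basis image_comp map_prod.comp)
  qed
qed

section \<open>The operad of the compositions \<open>\<bullet>\<close>\<close>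

lemma finite_nonempty_insert_at:
  "\<lbrakk>finite_nonempty A; finite_nonempty B\<rbrakk> \<Longrightarrow> finite_nonempty (insert_at A a B)"
  by (simp add: insert_at_def)

definition collapse :: "'a \<Rightarrow> 'a set \<Rightarrow> 'a \<Rightarrow> 'a" where
  "collapse a B x = (if x \<in> B then a else x)"

text \<open>Three of the four clauses of \<open>bullet_order\<close> are a single one: outside B x B
  the order is the pullback of r along the map contracting B to a. Arguments about the composite can
  then be made in r after collapsing.\<close>

lemma bullet_order_iff:
  assumes "A \<inter> B = {}"
  shows "(x, y) \<in> bullet_order A a B r s \<longleftrightarrow>
    x \<in> insert_at A a B \<and> y \<in> insert_at A a B \<and>
    (if x \<in> B \<and> y \<in> B then (x, y) \<in> s else (collapse a B x, collapse a B y) \<in> r)"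
  using assms by (auto simp: bullet_order_def insert_at_def collapse_def)

text \<open>Within B the axioms come from s, and elsewhere from r by collapsing. What remains is
  that a chain cannot leave B and return, and that a point outside B cannot be identified with a,
  which has been removed.\<close>

lemma partial_order_on_bullet_order:
  assumes "A \<inter> B = {}" "a \<in> A" "partial_order_on A r" "partial_order_on B s"
  shows "partial_order_on (insert_at A a B) (bullet_order A a B r s)"
proof -
  have refl: "\<And>x. x \<in> A \<Longrightarrow> (x, x) \<in> r" "\<And>x. x \<in> B \<Longrightarrow> (x, x) \<in> s"
    and trans: "\<And>x y z. (x, y) \<in> r \<Longrightarrow> (y, z) \<in> r \<Longrightarrow> (x, z) \<in> r"
      "\<And>x y z. (x, y) \<in> s \<Longrightarrow> (y, z) \<in> s \<Longrightarrow> (x, z) \<in> s"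
    and antisym: "\<And>x y. (x, y) \<in> r \<Longrightarrow> (y, x) \<in> r \<Longrightarrow> x = y"
      "\<And>x y. (x, y) \<in> s \<Longrightarrow> (y, x) \<in> s \<Longrightarrow> x = y"
    using assms(3,4) unfolding partial_order_on_iff by blast+
  note mem = bullet_order_iff[OF assms(1), of _ _ a r s]
  show ?thesis
    unfolding partial_order_on_iff
  proof (intro conjI allI impI ballI)
    show "bullet_order A a B r s \<subseteq> insert_at A a B \<times> insert_at A a B"
      by (auto simp: mem)
    show "(x, x) \<in> bullet_order A a B r s" if "x \<in> insert_at A a B" for x
      using that refl by (auto simp: mem collapse_def insert_at_def)
    show "(x, z) \<in> bullet_order A a B r s"
      if h: "(x, y) \<in> bullet_order A a B r s \<and> (y, z) \<in> bullet_order A a B r s" for x y z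
    proof (cases "x \<in> B \<and> z \<in> B")
      case True
      \<comment> \<open>Otherwise a <= y <= a in r would force y = a, although y lies in A without
        a.\<close>
      have "y \<in> B"
      proof (rule ccontr)
        assume "y \<notin> B"
        then have "(a, y) \<in> r" "(y, a) \<in> r" "y \<noteq> a"
          using h True by (auto simp: mem collapse_def insert_at_def)
        then show False using antisym(1) by blast
      qed
      then show ?thesis
        using h True trans(2)[of x y z] by (simp add: mem)
    next
      case False
      \<comment> \<open>One of the two steps may stay inside B and be governed by s. It collapses to
        (a, a), which lies in r by reflexivity.\<close>
      have "(collapse a B x, collapse a B y) \<in> r" "(collapse a B y, collapse a B z) \<in> r"
        using h refl(1)[OF assms(2)] by (auto simp: mem collapse_def split: if_splits)
      from trans(1)[OF this] show ?thesis
        using h False by (auto simp: mem)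
    qed
    show "x = y"
      if h: "(x, y) \<in> bullet_order A a B r s \<and> (y, x) \<in> bullet_order A a B r s" for x y
    proof (cases "x \<in> B \<and> y \<in> B")
      case True
      then show ?thesis using h antisym(2)[of x y] by (simp add: mem)
    next
      case False
      then have "collapse a B x = collapse a B y"
        using h by (intro antisym(1)) (auto simp: mem)
      then show ?thesis
        using h False by (auto simp: mem collapse_def insert_at_def split: if_splits)
    qed
  qed
qed

text \<open>Pairs inside B are compared by s and pairs inside C by u. Every other pair is compared
  by r after contracting B to a and C to a', and these two contractions commute.\<close>

lemma bullet_order_parallel:
  assumes "A \<inter> B = {}" "A \<inter> C = {}" "B \<inter> C = {}" "a \<in> A" "a' \<in> A" "a \<noteq> a'"
  shows "bullet_order (insert_at A a B) a' C (bullet_order A a B r s) u =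
    bullet_order (insert_at A a' C) a B (bullet_order A a' C r u) s"
proof (rule set_eqI, unfold split_paired_all)
  fix x y
  \<comment> \<open>The three sets are disjoint, so a point lies in exactly one of them or in none.
    For each of the sixteen combinations for x and y the definitions reduce to the same
    condition.\<close>
  have cases: "z \<in> A \<and> z \<notin> B \<and> z \<notin> C \<or> z \<notin> A \<and> z \<in> B \<and> z \<notin> C \<or>
      z \<notin> A \<and> z \<notin> B \<and> z \<in> C \<or> z \<notin> A \<and> z \<notin> B \<and> z \<notin> C" for z
    using assms(1-3) by blast
  have "a \<notin> B" "a \<notin> C" "a' \<notin> B" "a' \<notin> C"
    using assms by auto
  then show "(x, y) \<in> bullet_order (insert_at A a B) a' C (bullet_order A a B r s) u \<longleftrightarrow>
      (x, y) \<in> bullet_order (insert_at A a' C) a B (bullet_order A a' C r u) s"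
    using cases[of x] cases[of y] assms(4-)
    by (elim disjE conjE; simp add: bullet_order_def insert_at_def; blast)
qed

text \<open>On both sides a pair inside C is compared by u. Failing that, a pair of inserted points
  is compared by s after contracting C to b, and any other pair by r after contracting all inserted
  points to a.\<close>

lemma bullet_order_nested:
  assumes "A \<inter> B = {}" "A \<inter> C = {}" "B \<inter> C = {}" "a \<in> A" "b \<in> B"
  shows "bullet_order (insert_at A a B) b C (bullet_order A a B r s) u =
    bullet_order A a (insert_at B b C) r (bullet_order B b C s u)"
proof (rule set_eqI, unfold split_paired_all)
  fix x y
  have cases: "z \<in> A \<and> z \<notin> B \<and> z \<notin> C \<or> z \<notin> A \<and> z \<in> B \<and> z \<notin> C \<or>
      z \<notin> A \<and> z \<notin> B \<and> z \<in> C \<or> z \<notin> A \<and> z \<notin> B \<and> z \<notin> C" for z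
    using assms(1-3) by blast
  have "a \<notin> B" "a \<notin> C" "b \<notin> A" "b \<notin> C"
    using assms by auto
  then show "(x, y) \<in> bullet_order (insert_at A a B) b C (bullet_order A a B r s) u \<longleftrightarrow>
      (x, y) \<in> bullet_order A a (insert_at B b C) r (bullet_order B b C s u)"
    using cases[of x] cases[of y] assms(4-)
    by (elim disjE conjE; simp add: bullet_order_def insert_at_def; blast)
qed

lemma map_prod_image_eqI:
  assumes "P \<subseteq> I \<times> I" "Q \<subseteq> \<rho> ` I \<times> \<rho> ` I"
    and "\<And>x y. x \<in> I \<Longrightarrow> y \<in> I \<Longrightarrow> (\<rho> x, \<rho> y) \<in> Q \<longleftrightarrow> (x, y) \<in> P"
  shows "map_prod \<rho> \<rho> ` P = Q"
  using assms by (force simp: image_iff)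

lemma bij_betw_insert_at:
  assumes "A \<inter> B = {}" "a \<in> A" "bij_betw \<sigma> A A'" "bij_betw \<tau> B B'" "A' \<inter> B' = {}"
  shows "bij_betw (\<lambda>x. if x \<in> B then \<tau> x else \<sigma> x) (insert_at A a B) (insert_at A' (\<sigma> a) B')"
proof -
  have "bij_betw \<sigma> (A - {a}) (A' - {\<sigma> a})"
    using assms(2,3) by (auto simp: bij_betw_def inj_on_def)
  then have "bij_betw (\<lambda>x. if x \<in> B then \<tau> x else \<sigma> x) (A - {a}) (A' - {\<sigma> a})"
    by (rule bij_betw_cong[THEN iffD1, rotated]) (use assms(1) in auto)
  moreover have "bij_betw (\<lambda>x. if x \<in> B then \<tau> x else \<sigma> x) B B'"
    by (rule bij_betw_cong[THEN iffD1, OF _ assms(4)]) auto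
  ultimately show ?thesis
    unfolding insert_at_def by (rule bij_betw_combine) (use assms(5) in auto)
qed

text \<open>The relabelling \<open>\<rho>\<close> intertwines the two contractions: contracting B'
  to \<open>\<sigma> a\<close> after \<open>\<rho>\<close> is the same as contracting B to a and
  then applying \<open>\<sigma>\<close>. This is the fact \<open>col\<close>; it reduces the claim
  to relabelling of r and s separately.\<close>

lemma bullet_order_natural:
  assumes "A \<inter> B = {}" "a \<in> A" "bij_betw \<sigma> A A'" "bij_betw \<tau> B B'" "A' \<inter> B' = {}"
    and "r \<subseteq> A \<times> A" "s \<subseteq> B \<times> B"
  defines "\<rho> \<equiv> \<lambda>x. if x \<in> B then \<tau> x else \<sigma> x"
  shows "map_prod \<rho> \<rho> ` bullet_order A a B r s =
    bullet_order A' (\<sigma> a) B' (map_prod \<sigma> \<sigma> ` r) (map_prod \<tau> \<tau> ` s)"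
proof (rule map_prod_image_eqI)
  have im: "\<rho> ` insert_at A a B = insert_at A' (\<sigma> a) B'"
    unfolding \<rho>_def by (rule bij_betw_imp_surj_on[OF bij_betw_insert_at[OF assms(1-5)]])
  note mem = bullet_order_iff[OF assms(1)] bullet_order_iff[OF assms(5)]
  show "bullet_order A a B r s \<subseteq> insert_at A a B \<times> insert_at A a B"
    by (auto simp: mem)
  show "bullet_order A' (\<sigma> a) B' (map_prod \<sigma> \<sigma> ` r) (map_prod \<tau> \<tau> ` s) \<subseteq>
      \<rho> ` insert_at A a B \<times> \<rho> ` insert_at A a B"
    unfolding im by (auto simp: mem)
  have inB: "\<rho> x \<in> B' \<longleftrightarrow> x \<in> B" and col: "collapse (\<sigma> a) B' (\<rho> x) = \<sigma> (collapse a B x)"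
    and colA: "collapse a B x \<in> A" and im': "\<rho> x \<in> insert_at A' (\<sigma> a) B'"
    if "x \<in> insert_at A a B" for x
  proof -
    show *: "\<rho> x \<in> B' \<longleftrightarrow> x \<in> B"
      using that bij_betwE[OF assms(3)] bij_betwE[OF assms(4)] assms(5)
      by (auto simp: \<rho>_def insert_at_def)
    show "collapse (\<sigma> a) B' (\<rho> x) = \<sigma> (collapse a B x)"
      using * by (simp add: collapse_def \<rho>_def)
    show "collapse a B x \<in> A"
      using that assms(2) by (auto simp: collapse_def insert_at_def)
    show "\<rho> x \<in> insert_at A' (\<sigma> a) B'"
      using that im by auto
  qed
  fix x y
  assume xy: "x \<in> insert_at A a B" "y \<in> insert_at A a B"
  have "(\<rho> x, \<rho> y) \<in> map_prod \<tau> \<tau> ` s \<longleftrightarrow> (x, y) \<in> s" if "x \<in> B" "y \<in> B"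
    using map_prod_image_mem_iff[OF bij_betw_imp_inj_on[OF assms(4)] assms(7) that] that
    by (simp add: \<rho>_def)
  then show "(\<rho> x, \<rho> y) \<in> bullet_order A' (\<sigma> a) B' (map_prod \<sigma> \<sigma> ` r) (map_prod \<tau> \<tau> ` s) \<longleftrightarrow>
      (x, y) \<in> bullet_order A a B r s"
    using xy map_prod_image_mem_iff[OF bij_betw_imp_inj_on[OF assms(3)] assms(6) colA colA, of x y]
    by (simp add: mem inB col im')
qed

lemma bullet_order_unit_left: "s \<subseteq> B \<times> B \<Longrightarrow> bullet_order {a} a B {(a, a)} s = s"
  by (auto simp: bullet_order_def)

text \<open>When the inserted set is a single point b, contracting it to a is inverse to renaming a
  to b, so the pullback of r is its relabelling.\<close>

lemma bullet_order_unit_right: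
  assumes "a \<in> A" "b \<notin> A" "partial_order_on A r"
  shows "bullet_order A a {b} r {(b, b)} = map_prod (id(a := b)) (id(a := b)) ` r"
proof (rule map_prod_image_eqI[symmetric])
  show "r \<subseteq> A \<times> A" by (rule partial_order_onD(4)[OF assms(3)])
  have im: "id(a := b) ` A = insert_at A a {b}"
    using assms(1) by (auto simp: insert_at_def)
  have disj: "A \<inter> {b} = {}" using assms(2) by simp
  show "bullet_order A a {b} r {(b, b)} \<subseteq> id(a := b) ` A \<times> id(a := b) ` A"
    unfolding im by (auto simp: bullet_order_iff[OF disj])
  \<comment> \<open>The pair (b, b) is decided by the unit order instead of by r; the two agree
    because r is reflexive at a.\<close>
  have "(a, a) \<in> r"
    using assms(1) partial_order_onD(1)[OF assms(3)] by (simp add: refl_on_def)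
  moreover fix x y assume "x \<in> A" "y \<in> A"
  ultimately show "((id(a := b)) x, (id(a := b)) y) \<in> bullet_order A a {b} r {(b, b)} \<longleftrightarrow> (x, y) \<in> r"
    using assms(2) by (auto simp: bullet_order_iff[OF disj] collapse_def insert_at_def)
qed

section \<open>Bilinear extension of the bullet composites and the operad axioms\<close>

lemma bullet_comp_basis [simp]:
  "bullet_comp A a B (basis_vec r) (basis_vec s) = basis_vec (bullet_order A a B r s)"
  by (simp add: bullet_comp_def)

lemma flinear_bullet_comp_left: "flinear (\<lambda>X. bullet_comp A a B X Y)"
  unfolding bullet_comp_def by (rule flinear_bilinear_ext_left)

lemma flinear_bullet_comp_right: "flinear (bullet_comp A a B X)"
  unfolding bullet_comp_def by (rule flinear_bilinear_ext_right)

lemmas flinear_bullet_intros =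
  flinear_bullet_comp_left flinear_bullet_comp_right flinear_poset_act
  flinear_compose[OF flinear_bullet_comp_left flinear_bullet_comp_left]
  flinear_compose[OF flinear_bullet_comp_left flinear_bullet_comp_right]
  flinear_compose[OF flinear_bullet_comp_right flinear_bullet_comp_left]
  flinear_compose[OF flinear_bullet_comp_right flinear_bullet_comp_right]
  flinear_compose[OF flinear_poset_act flinear_bullet_comp_left]
  flinear_compose[OF flinear_poset_act flinear_bullet_comp_right]
  flinear_compose[OF flinear_bullet_comp_left flinear_poset_act]
  flinear_compose[OF flinear_bullet_comp_right flinear_poset_act]

lemma bullet_comp_in_poset_space:
  assumes "A \<inter> B = {}" "a \<in> A" "X \<in> poset_space A" "Y \<in> poset_space B"
  shows "bullet_comp A a B X Y \<in> poset_space (insert_at A a B)"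
  by (rule flinear_in_poset_space[OF flinear_bullet_comp_left assms(3)],
      rule flinear_in_poset_space[OF flinear_bullet_comp_right assms(4)])
     (simp add: partial_order_on_bullet_order[OF assms(1,2)])

lemma linear_operad_bullet:
  "linear_operad (fscale :: 'k::field \<Rightarrow> ('a rel \<Rightarrow>\<^sub>0 'k) \<Rightarrow> _)
     poset_space poset_act bullet_comp poset_unit"
proof (intro linear_operad.intro linear_species_poset linear_operad_axioms.intro, goal_cases)
  case (1 A B a Y)
  then show ?case
    by (intro linear_map_on_flinear flinear_bullet_comp_left bullet_comp_in_poset_space)
next
  case (2 A B a X)
  then show ?case
    by (intro linear_map_on_flinear flinear_bullet_comp_right bullet_comp_in_poset_space)
next
  case (3 A B a \<sigma> A' \<tau> B' X Y)
  show ?case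
  proof (rule flinear_eqI2[OF _ _ _ _ \<open>X \<in> _\<close> \<open>Y \<in> _\<close>,
        where f = "\<lambda>X Y. poset_act (insert_at A a B) (\<lambda>x. if x \<in> B then \<tau> x else \<sigma> x)
            (bullet_comp A a B X Y)"
        and g = "\<lambda>X Y. bullet_comp A' (\<sigma> a) B' (poset_act A \<sigma> X) (poset_act B \<tau> Y)"])
    fix r s
    assume "partial_order_on A r" "partial_order_on B s"
    from bullet_order_natural[OF 3(3-7) this[THEN partial_order_onD(4)]]
    show "poset_act (insert_at A a B) (\<lambda>x. if x \<in> B then \<tau> x else \<sigma> x)
        (bullet_comp A a B (basis_vec r) (basis_vec s)) =
      bullet_comp A' (\<sigma> a) B' (poset_act A \<sigma> (basis_vec r)) (poset_act B \<tau> (basis_vec s))"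
      by simp
  qed (rule flinear_bullet_intros)+
next
  case (4 A B C a a' X Y Z)
  show ?case
    by (rule flinear_eqI3[OF _ _ _ _ _ _ \<open>X \<in> _\<close> \<open>Y \<in> _\<close> \<open>Z \<in> _\<close>,
        where f = "\<lambda>X Y Z. bullet_comp (insert_at A a B) a' C (bullet_comp A a B X Y) Z"
        and g = "\<lambda>X Y Z. bullet_comp (insert_at A a' C) a B (bullet_comp A a' C X Z) Y"];
       (rule flinear_bullet_intros |
        simp only: bullet_comp_basis bullet_order_parallel[OF 4(4-9)]))
next
  case (5 A B C a b X Y Z)
  show ?case
    by (rule flinear_eqI3[OF _ _ _ _ _ _ \<open>X \<in> _\<close> \<open>Y \<in> _\<close> \<open>Z \<in> _\<close>,
        where f = "\<lambda>X Y Z. bullet_comp (insert_at A a B) b C (bullet_comp A a B X Y) Z"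
        and g = "\<lambda>X Y Z. bullet_comp A a (insert_at B b C) X (bullet_comp B b C Y Z)"];
       (rule flinear_bullet_intros |
        simp only: bullet_comp_basis bullet_order_nested[OF 5(4-8)]))
next
  case (6 a)
  show ?case by (simp add: poset_unit_def partial_order_on_iff)
next
  case (7 a \<sigma>)
  show ?case by (simp add: poset_unit_def)
next
  case (8 B a Y)
  show ?case
    by (rule flinear_eqI[OF flinear_bullet_comp_right fs.linear_ident \<open>Y \<in> _\<close>])
       (simp add: poset_unit_def bullet_order_unit_left partial_order_onD(4))
next
  case (9 A a b X)
  show ?case
    by (rule flinear_eqI[OF flinear_bullet_comp_left flinear_poset_act \<open>X \<in> _\<close>])
       (simp add: poset_unit_def bullet_order_unit_right 9)
qed

section \<open>Transport of an operad structure\<close>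

lemma finite_nonempty_bij_betw: "\<lbrakk>finite_nonempty A; bij_betw \<sigma> A B\<rbrakk> \<Longrightarrow> finite_nonempty B"
  by (auto simp: bij_betw_def)

lemma bij_betw_rename:
  assumes "a \<in> A" "b \<notin> A"
  shows "bij_betw (id(a := b)) A (insert_at A a {b})"
  using assms by (auto simp: bij_betw_def inj_on_def insert_at_def)

lemma insert_at_commute:
  "\<lbrakk>A \<inter> B = {}; A \<inter> C = {}; B \<inter> C = {}; a \<in> A; a' \<in> A\<rbrakk> \<Longrightarrow>
    insert_at (insert_at A a B) a' C = insert_at (insert_at A a' C) a B"
  by (auto simp: insert_at_def)

lemma insert_at_insert_at:
  "\<lbrakk>A \<inter> B = {}; b \<in> B\<rbrakk> \<Longrightarrow>
    insert_at (insert_at A a B) b C = insert_at A a (insert_at B b C)"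
  by (auto simp: insert_at_def)

text \<open>Every element of \<open>S2 A\<close> is the image of an element of \<open>S1 A\<close>,
  so each axiom for \<open>comp2\<close> is the image under \<open>\<psi>\<close> of the same axiom
  for \<open>comp1\<close>. The hypothesis \<open>comp\<close> is all that is asked of
  \<open>comp2\<close>: even its bilinearity and the location of its values are conclusions.\<close>

lemma linear_operad_transport:
  assumes op: "linear_operad s1 S1 act1 comp1 unit1"
    and sp: "linear_species s2 S2 act2"
    and lin: "\<And>A. finite_nonempty A \<Longrightarrow> linear_map_on s1 s2 (S1 A) (S2 A) (\<psi> A)"
    and bij: "\<And>A. finite_nonempty A \<Longrightarrow> bij_betw (\<psi> A) (S1 A) (S2 A)"
    and nat: "\<And>A \<sigma> B X. \<lbrakk>finite_nonempty A; bij_betw \<sigma> A B; X \<in> S1 A\<rbrakk> \<Longrightarrow>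
      \<psi> B (act1 A \<sigma> X) = act2 A \<sigma> (\<psi> A X)"
    and comp: "\<And>A B a X Y. \<lbrakk>finite_nonempty A; finite_nonempty B; A \<inter> B = {}; a \<in> A; X \<in> S1 A;
      Y \<in> S1 B\<rbrakk> \<Longrightarrow> \<psi> (insert_at A a B) (comp1 A a B X Y) = comp2 A a B (\<psi> A X) (\<psi> B Y)"
    and unit: "\<And>a. \<psi> {a} (unit1 a) = unit2 a"
  shows "linear_operad s2 S2 act2 comp2 unit2"
proof -
  interpret op: linear_operad s1 S1 act1 comp1 unit1 by (rule op)
  have lift: "\<exists>X'\<in>S1 A. X = \<psi> A X'" if "finite_nonempty A" "X \<in> S2 A" for A X
    using bij_betw_imp_surj_on[OF bij[OF that(1)]] that(2) by blast
  have mem: "\<psi> A X \<in> S2 A" and add: "\<psi> A (X + Y) = \<psi> A X + \<psi> A Y"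
    and scale: "\<psi> A (s1 c X) = s2 c (\<psi> A X)"
    if "finite_nonempty A" "X \<in> S1 A" "Y \<in> S1 A" for A X Y c
    using lin[OF that(1)] that(2,3) by (auto simp: linear_map_on_def)
  have S1_add: "X + Y \<in> S1 A" and S1_scale: "s1 c X \<in> S1 A"
    if "finite_nonempty A" "X \<in> S1 A" "Y \<in> S1 A" for A X Y c
    using op.subspace_S[OF that(1)] that(2,3) op.subspace_add op.subspace_scale by auto
  have act_in: "act1 A \<sigma> X \<in> S1 B" if "finite_nonempty A" "bij_betw \<sigma> A B" "X \<in> S1 A" for A B \<sigma> X
    by (rule linear_map_on_in[OF op.act_linear[OF that(1,2)] that(3)])
  have comp_in: "comp1 A a B X Y \<in> S1 (insert_at A a B)"
    if "finite_nonempty A" "finite_nonempty B" "A \<inter> B = {}" "a \<in> A" "X \<in> S1 A" "Y \<in> S1 B"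
    for A B a X Y
    by (rule linear_map_on_in[OF op.comp_linear_left[OF that(1-4,6)] that(5)])
  note fn = finite_nonempty_insert_at
  show ?thesis
  proof (intro linear_operad.intro sp linear_operad_axioms.intro, goal_cases)
    case (1 A B a Y)
    obtain Y' where Y': "Y' \<in> S1 B" "Y = \<psi> B Y'" using lift 1 by blast
    \<comment> \<open>\<open>c\<close> turns a composite of images into the image of a composite,
      and \<open>i\<close> places that composite in the domain on which \<open>\<psi>\<close> is
      known to be linear.\<close>
    note c = comp[OF 1(1-4) _ Y'(1), symmetric] and i = comp_in[OF 1(1-4) _ Y'(1)]
    note l = op.comp_linear_left[OF 1(1-4) Y'(1), unfolded linear_map_on_def]
    show ?case
      unfolding linear_map_on_def
    proof (intro conjI allI ballI)
      fix X assume "X \<in> S2 A"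
      then obtain X' where X': "X' \<in> S1 A" "X = \<psi> A X'" using lift 1(1) by blast
      show "comp2 A a B X Y \<in> S2 (insert_at A a B)"
        using X' Y' mem[OF fn[OF 1(1,2)] i i] by (simp add: c)
      show "comp2 A a B (s2 k X) Y = s2 k (comp2 A a B X Y)" for k
        using X' Y' scale[OF fn[OF 1(1,2)] i i] l
        by (simp add: c scale[OF 1(1), symmetric] S1_scale 1(1))
      fix Z assume "Z \<in> S2 A"
      then obtain Z' where Z': "Z' \<in> S1 A" "Z = \<psi> A Z'" using lift 1(1) by blast
      show "comp2 A a B (X + Z) Y = comp2 A a B X Y + comp2 A a B Z Y"
        using X' Y' Z' add[OF fn[OF 1(1,2)] i i] l
        by (simp add: c add[OF 1(1), symmetric] S1_add 1(1))
    qed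
  next
    case (2 A B a X)
    obtain X' where X': "X' \<in> S1 A" "X = \<psi> A X'" using lift 2 by blast
    note c = comp[OF 2(1-4) X'(1), symmetric] and i = comp_in[OF 2(1-4) X'(1)]
    note l = op.comp_linear_right[OF 2(1-4) X'(1), unfolded linear_map_on_def]
    show ?case
      unfolding linear_map_on_def
    proof (intro conjI allI ballI)
      fix Y assume "Y \<in> S2 B"
      then obtain Y' where Y': "Y' \<in> S1 B" "Y = \<psi> B Y'" using lift 2(2) by blast
      show "comp2 A a B X Y \<in> S2 (insert_at A a B)"
        using X' Y' mem[OF fn[OF 2(1,2)] i i] by (simp add: c)
      show "comp2 A a B X (s2 k Y) = s2 k (comp2 A a B X Y)" for k
        using X' Y' scale[OF fn[OF 2(1,2)] i i] l
        by (simp add: c scale[OF 2(2), symmetric] S1_scale 2(2))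
      fix Z assume "Z \<in> S2 B"
      then obtain Z' where Z': "Z' \<in> S1 B" "Z = \<psi> B Z'" using lift 2(2) by blast
      show "comp2 A a B X (Y + Z) = comp2 A a B X Y + comp2 A a B X Z"
        using X' Y' Z' add[OF fn[OF 2(1,2)] i i] l
        by (simp add: c add[OF 2(2), symmetric] S1_add 2(2))
    qed
  next
    case (3 A B a \<sigma> A' \<tau> B' X Y)
    obtain X' Y' where XY: "X' \<in> S1 A" "X = \<psi> A X'" "Y' \<in> S1 B" "Y = \<psi> B Y'"
      using lift 3 by meson
    let ?\<rho> = "\<lambda>x. if x \<in> B then \<tau> x else \<sigma> x"
    have "act2 (insert_at A a B) ?\<rho> (comp2 A a B X Y) =
        \<psi> (insert_at A' (\<sigma> a) B') (act1 (insert_at A a B) ?\<rho> (comp1 A a B X' Y'))"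
      using nat[OF fn[OF 3(1,2)] bij_betw_insert_at[OF 3(3-7)] comp_in[OF 3(1-4) XY(1,3)]]
        comp[OF 3(1-4) XY(1,3)] by (simp add: XY)
    also have "act1 (insert_at A a B) ?\<rho> (comp1 A a B X' Y') =
        comp1 A' (\<sigma> a) B' (act1 A \<sigma> X') (act1 B \<tau> Y')"
      by (rule op.comp_natural[OF 3(1-7) XY(1,3)])
    also have "\<psi> (insert_at A' (\<sigma> a) B') \<dots> =
        comp2 A' (\<sigma> a) B' (\<psi> A' (act1 A \<sigma> X')) (\<psi> B' (act1 B \<tau> Y'))"
      by (rule comp[OF finite_nonempty_bij_betw[OF 3(1,5)] finite_nonempty_bij_betw[OF 3(2,6)] 3(7)
            bij_betw_apply[OF 3(5,4)] act_in[OF 3(1,5) XY(1)] act_in[OF 3(2,6) XY(3)]])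
    also have "\<dots> = comp2 A' (\<sigma> a) B' (act2 A \<sigma> X) (act2 B \<tau> Y)"
      using nat[OF 3(1,5) XY(1)] nat[OF 3(2,6) XY(3)] by (simp add: XY)
    finally show ?case .
  next
    case (4 A B C a a' X Y Z)
    obtain X' Y' Z' where XYZ: "X' \<in> S1 A" "X = \<psi> A X'" "Y' \<in> S1 B" "Y = \<psi> B Y'"
      "Z' \<in> S1 C" "Z = \<psi> C Z'"
      using lift 4 by meson
    have d: "insert_at A a B \<inter> C = {}" "a' \<in> insert_at A a B"
      "insert_at A a' C \<inter> B = {}" "a \<in> insert_at A a' C"
      using 4 by (auto simp: insert_at_def)
    \<comment> \<open>The two iterated composites are images under \<open>\<psi>\<close> taken at
      differently written sets, so the equality of these sets is needed besides the axiom for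
      \<open>comp1\<close>.\<close>
    show ?case
      using comp[OF 4(1,2,4,7) XYZ(1,3)] comp[OF 4(1,3,5,8) XYZ(1,5)]
        comp[OF fn[OF 4(1,2)] 4(3) d(1,2) comp_in[OF 4(1,2,4,7) XYZ(1,3)] XYZ(5)]
        comp[OF fn[OF 4(1,3)] 4(2) d(3,4) comp_in[OF 4(1,3,5,8) XYZ(1,5)] XYZ(3)]
        op.comp_parallel[OF 4(1-9) XYZ(1,3,5)]
        insert_at_commute[OF 4(4-8)]
      by (simp add: XYZ)
  next
    case (5 A B C a b X Y Z)
    obtain X' Y' Z' where XYZ: "X' \<in> S1 A" "X = \<psi> A X'" "Y' \<in> S1 B" "Y = \<psi> B Y'"
      "Z' \<in> S1 C" "Z = \<psi> C Z'"
      using lift 5 by meson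
    have d: "insert_at A a B \<inter> C = {}" "b \<in> insert_at A a B" "A \<inter> insert_at B b C = {}"
      using 5 by (auto simp: insert_at_def)
    show ?case
      using comp[OF 5(1,2,4,7) XYZ(1,3)] comp[OF 5(2,3,6,8) XYZ(3,5)]
        comp[OF fn[OF 5(1,2)] 5(3) d(1,2) comp_in[OF 5(1,2,4,7) XYZ(1,3)] XYZ(5)]
        comp[OF 5(1) fn[OF 5(2,3)] d(3) 5(7) XYZ(1) comp_in[OF 5(2,3,6,8) XYZ(3,5)]]
        op.comp_nested[OF 5(1-8) XYZ(1,3,5)]
        insert_at_insert_at[OF 5(4,8)]
      by (simp add: XYZ)
  next
    case (6 a)
    show ?case using mem[of "{a}" "unit1 a" "unit1 a"] op.unit_in by (simp add: unit)
  next
    case (7 a \<sigma>)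
    show ?case
      using nat[of "{a}" \<sigma> "{\<sigma> a}" "unit1 a"] op.unit_in op.unit_natural
      by (simp add: unit)
  next
    case (8 B a Y)
    obtain Y' where Y': "Y' \<in> S1 B" "Y = \<psi> B Y'" using lift 8 by blast
    show ?case
      using comp[of "{a}" B a "unit1 a" Y'] op.unit_left[OF 8(1,2) Y'(1)] op.unit_in Y' 8
      by (simp add: unit insert_at_def)
  next
    case (9 A a b X)
    obtain X' where X': "X' \<in> S1 A" "X = \<psi> A X'" using lift 9 by blast
    show ?case
      using comp[of A "{b}" a X' "unit1 b"] op.unit_right[OF 9(1-3) X'(1)] op.unit_in X' 9
        nat[OF 9(1) bij_betw_rename[OF 9(2,3)] X'(1)]
      by (simp add: unit)
  qed
qed

text \<open>The explicit map of this development leads from bullet to circ. This lemma reverses it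
  abstractly, cancelling \<open>\<psi>\<close> on elements known to lie in its domain.\<close>

lemma linear_operad_iso_inverse:
  assumes "linear_operad_iso s1 S1 act1 comp1 unit1 s2 S2 act2 comp2 unit2 \<psi>"
  shows "linear_operad_iso s2 S2 act2 comp2 unit2 s1 S1 act1 comp1 unit1
    (\<lambda>A. inv_into (S1 A) (\<psi> A))"
proof -
  interpret iso: linear_operad_iso s1 S1 act1 comp1 unit1 s2 S2 act2 comp2 unit2 \<psi> by (rule assms)
  have inv: "inv_into (S1 A) (\<psi> A) (\<psi> A X) = X" if "finite_nonempty A" "X \<in> S1 A" for A X
    using bij_betw_inv_into_left[OF iso.iso_bij[OF that(1)] that(2)] .
  have lift: "\<exists>X'\<in>S1 A. X = \<psi> A X'" if "finite_nonempty A" "X \<in> S2 A" for A X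
    using bij_betw_imp_surj_on[OF iso.iso_bij[OF that(1)]] that(2) by blast
  note S1 = iso.source.subspace_S
  show ?thesis
  proof (intro linear_operad_iso.intro iso.source.linear_operad_axioms
      iso.target.linear_operad_axioms linear_operad_iso_axioms.intro, goal_cases)
    case (1 A)
    have "inv_into (S1 A) (\<psi> A) (X + Y) = inv_into (S1 A) (\<psi> A) X + inv_into (S1 A) (\<psi> A) Y"
      "inv_into (S1 A) (\<psi> A) (s2 c X) = s1 c (inv_into (S1 A) (\<psi> A) X)"
      if XY: "X \<in> S2 A" "Y \<in> S2 A" for X Y c
    proof -
      obtain X' Y' where h: "X' \<in> S1 A" "X = \<psi> A X'" "Y' \<in> S1 A" "Y = \<psi> A Y'"
        using lift[OF 1] XY by meson
      have "X' + Y' \<in> S1 A" "s1 c X' \<in> S1 A"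
        using S1[OF 1] h iso.source.subspace_add iso.source.subspace_scale by auto
      moreover have "\<psi> A (X' + Y') = X + Y" "\<psi> A (s1 c X') = s2 c X"
        using iso.iso_linear[OF 1] h by (auto simp: linear_map_on_def)
      ultimately show "inv_into (S1 A) (\<psi> A) (X + Y) =
          inv_into (S1 A) (\<psi> A) X + inv_into (S1 A) (\<psi> A) Y"
        "inv_into (S1 A) (\<psi> A) (s2 c X) = s1 c (inv_into (S1 A) (\<psi> A) X)"
        using inv[OF 1] h by metis+
    qed
    moreover have "inv_into (S1 A) (\<psi> A) X \<in> S1 A" if "X \<in> S2 A" for X
      using bij_betwE[OF bij_betw_inv_into[OF iso.iso_bij[OF 1]]] that by blast
    ultimately show ?case by (simp add: linear_map_on_def)
  next
    case (2 A)
    show ?case by (rule bij_betw_inv_into[OF iso.iso_bij[OF 2]])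
  next
    case (3 A \<sigma> B X)
    obtain X' where X': "X' \<in> S1 A" "X = \<psi> A X'" using lift 3 by blast
    have "act1 A \<sigma> X' \<in> S1 B"
      by (rule linear_map_on_in[OF iso.source.act_linear[OF 3(1,2)] X'(1)])
    then show ?case
      using iso.iso_natural[OF 3(1,2) X'(1), symmetric] X' inv 3(1)
        finite_nonempty_bij_betw[OF 3(1,2)] by simp
  next
    case (4 A B a X Y)
    obtain X' Y' where XY: "X' \<in> S1 A" "X = \<psi> A X'" "Y' \<in> S1 B" "Y = \<psi> B Y'"
      using lift 4 by meson
    have "comp1 A a B X' Y' \<in> S1 (insert_at A a B)"
      by (rule linear_map_on_in[OF iso.source.comp_linear_left[OF 4(1-4) XY(3)] XY(1)])
    then show ?case
      using iso.iso_comp[OF 4(1-4) XY(1,3), symmetric] inv XY 4(1,2)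
        finite_nonempty_insert_at[OF 4(1,2)] by simp
  next
    case (5 a)
    show ?case using inv[of "{a}" "unit1 a"] iso.iso_unit iso.source.unit_in by simp
  qed
qed

section \<open>The isomorphism\<close>

text \<open>These are not subposets: the ground set A is kept and only comparabilities are dropped.
  Equivalently, they are the orders on A of which r is an extension.\<close>

definition suborders :: "'a set \<Rightarrow> 'a rel \<Rightarrow> 'a rel set" where
  "suborders A r = {q. partial_order_on A q \<and> q \<subseteq> r}"

text \<open>On the span of the partial orders on A this is the zeta operator of their inclusion
  order.\<close>

definition suborder_sum :: "'a set \<Rightarrow> ('a rel \<Rightarrow>\<^sub>0 'k::field) \<Rightarrow> ('a rel \<Rightarrow>\<^sub>0 'k)" where
  "suborder_sum A = linear_ext (\<lambda>r. \<Sum>q\<in>suborders A r. basis_vec q)"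

lemma finite_partial_orders: "finite A \<Longrightarrow> finite {r. partial_order_on A r}"
  by (rule finite_subset[of _ "Pow (A \<times> A)"]) (auto dest: partial_order_onD(4))

lemma finite_suborders: "finite A \<Longrightarrow> finite (suborders A r)"
  by (rule finite_subset[OF _ finite_partial_orders]) (auto simp: suborders_def)

lemma flinear_suborder_sum: "flinear (suborder_sum A)"
  unfolding suborder_sum_def by (rule flinear_linear_ext)

lemma suborder_sum_basis [simp]:
  "suborder_sum A (basis_vec r) = (\<Sum>q\<in>suborders A r. basis_vec q)"
  by (simp add: suborder_sum_def)

lemma suborder_sum_in_poset_space: "X \<in> poset_space A \<Longrightarrow> suborder_sum A X \<in> poset_space A"
  by (erule flinear_in_poset_space[OF flinear_suborder_sum])
     (auto intro!: fs.subspace_sum subspace_poset_space simp: suborders_def)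

section \<open>Invertibility of the suborder sum\<close>

lemma lookup_sum_basis_vec:
  "finite Q \<Longrightarrow> Poly_Mapping.lookup (\<Sum>q\<in>Q. basis_vec q :: 'b \<Rightarrow>\<^sub>0 'k::field) m = (if m \<in> Q then 1 else 0)"
  by (simp add: lookup_sum basis_vec_def lookup_single when_def)

text \<open>The coefficient of an inclusion-maximal order is unchanged by \<^const>\<open>suborder_sum\<close>.\<close>

lemma suborder_sum_nonzero:
  assumes "finite A" "X \<in> poset_space A" "X \<noteq> 0"
  shows "suborder_sum A X \<noteq> 0"
proof -
  have "Poly_Mapping.keys X \<noteq> {}"
    using assms(3) by simp
  then obtain m where m: "m \<in> Poly_Mapping.keys X"
    and max: "\<And>r. r \<in> Poly_Mapping.keys X \<Longrightarrow> m \<subseteq> r \<Longrightarrow> r = m"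
    using finite_has_maximal[of "Poly_Mapping.keys X"] by auto
  have "Poly_Mapping.lookup (suborder_sum A X) m =
      (\<Sum>r\<in>Poly_Mapping.keys X. Poly_Mapping.lookup X r * (if m \<in> suborders A r then 1 else 0))"
    by (simp add: suborder_sum_def linear_ext_def lookup_sum[of _ "Poly_Mapping.keys X"]
        lookup_sum_basis_vec finite_suborders assms(1))
  also have "\<dots> = (\<Sum>r\<in>Poly_Mapping.keys X. if r = m then Poly_Mapping.lookup X m else 0)"
    by (rule sum.cong)
       (use m max assms(2) in \<open>auto simp: suborders_def poset_space_def\<close>)
  also have "\<dots> \<noteq> 0"
    using m by (simp add: in_keys_iff)
  finally show ?thesis by auto
qed

lemma subspace_image_suborder_sum:
  "fs.subspace (suborder_sum A ` (poset_space A :: ('a rel \<Rightarrow>\<^sub>0 'k::field) set))"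
  using flinear_suborder_sum subspace_poset_space
  by (intro module_hom.subspace_image[of fscale fscale]) (auto simp: Vector_Spaces.linear_def)

text \<open>Triangular elimination: \<open>basis_vec r\<close> is its own suborder sum minus the
  basis vectors of the strictly smaller orders. Those lie in the image by induction, and the image
  is a subspace.\<close>

lemma basis_vec_in_image_suborder_sum:
  assumes "finite A" "partial_order_on A r"
  shows "basis_vec r \<in> suborder_sum A ` (poset_space A :: ('a rel \<Rightarrow>\<^sub>0 'k::field) set)"
proof -
  let ?T = "suborder_sum A ` (poset_space A :: ('a rel \<Rightarrow>\<^sub>0 'k) set)"
  note T = subspace_image_suborder_sum[of A]
  have "finite r"
    using assms partial_order_onD(4) finite_subset by blast
  then show ?thesis
    using assms(2)
  proof (induction r rule: finite_psubset_induct)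
    case (psubset r)
    have "suborders A r = insert r (suborders A r - {r})"
      using psubset.prems by (auto simp: suborders_def)
    then have "suborder_sum A (basis_vec r) =
        basis_vec r + (\<Sum>q\<in>suborders A r - {r}. basis_vec q :: 'a rel \<Rightarrow>\<^sub>0 'k)"
      using sum.insert_remove[of "suborders A r" basis_vec r] finite_suborders[OF assms(1)]
      by (simp add: insert_absorb)
    then have "basis_vec r = suborder_sum A (basis_vec r) -
        (\<Sum>q\<in>suborders A r - {r}. basis_vec q :: 'a rel \<Rightarrow>\<^sub>0 'k)"
      by simp
    also have "\<dots> \<in> ?T"
      by (intro fs.subspace_diff[OF T] fs.subspace_sum[OF T])
         (use psubset in \<open>auto simp: suborders_def simp del: suborder_sum_basis\<close>)
    finally show ?case .
  qed
qed

lemma bij_betw_suborder_sum: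
  assumes "finite A"
  shows "bij_betw (suborder_sum A) (poset_space A :: ('a rel \<Rightarrow>\<^sub>0 'k::field) set) (poset_space A)"
proof (rule bij_betw_imageI)
  show "inj_on (suborder_sum A) (poset_space A :: ('a rel \<Rightarrow>\<^sub>0 'k) set)"
  proof (rule inj_onI, rule ccontr)
    fix X Y :: "'a rel \<Rightarrow>\<^sub>0 'k"
    assume h: "X \<in> poset_space A" "Y \<in> poset_space A" "suborder_sum A X = suborder_sum A Y" "X \<noteq> Y"
    \<comment> \<open>Linearity is available for sums, so the difference is reached by adding Y
      back.\<close>
    have "suborder_sum A (X - Y + Y) = suborder_sum A (X - Y) + suborder_sum A Y"
      using flinear_suborder_sum unfolding flinear_iff by blast
    then have "suborder_sum A (X - Y) = 0"
      using h(3) by simp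
    then show False
      using suborder_sum_nonzero[OF assms fs.subspace_diff[OF subspace_poset_space h(1,2)]] h(4)
      by simp
  qed
  show "suborder_sum A ` (poset_space A :: ('a rel \<Rightarrow>\<^sub>0 'k) set) = poset_space A"
  proof
    show "poset_space A \<subseteq> suborder_sum A ` (poset_space A :: ('a rel \<Rightarrow>\<^sub>0 'k) set)"
    proof
      fix X :: "'a rel \<Rightarrow>\<^sub>0 'k" assume X: "X \<in> poset_space A"
      note T = subspace_image_suborder_sum[of A]
      have "(\<Sum>r\<in>Poly_Mapping.keys X. fscale (Poly_Mapping.lookup X r) (basis_vec r)) \<in>
          suborder_sum A ` (poset_space A :: ('a rel \<Rightarrow>\<^sub>0 'k) set)"
        by (intro fs.subspace_sum[OF T] fs.subspace_scale[OF T] basis_vec_in_image_suborder_sum assms)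
           (use X in \<open>simp add: poset_space_def\<close>)
      then show "X \<in> suborder_sum A ` poset_space A"
        by (simp add: basis_expansion)
    qed
  qed (auto simp: suborder_sum_in_poset_space)
qed

section \<open>Naturality of the suborder sum\<close>

lemma suborders_relabel:
  assumes "bij_betw \<sigma> A B" "r \<subseteq> A \<times> A"
  shows "bij_betw ((`) (map_prod \<sigma> \<sigma>)) (suborders A r) (suborders B (map_prod \<sigma> \<sigma> ` r))"
proof (rule bij_betw_imageI)
  have inj: "inj_on \<sigma> A" by (rule bij_betw_imp_inj_on[OF assms(1)])
  show "inj_on ((`) (map_prod \<sigma> \<sigma>)) (suborders A r)"
    by (rule inj_on_subset[OF inj_on_image_Pow[OF map_prod_inj_on[OF inj inj]]])
       (auto simp: suborders_def dest: partial_order_onD(4))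
  show "(`) (map_prod \<sigma> \<sigma>) ` suborders A r = suborders B (map_prod \<sigma> \<sigma> ` r)"
  proof (intro equalityI subsetI)
    fix q assume q: "q \<in> suborders B (map_prod \<sigma> \<sigma> ` r)"
    let ?\<tau> = "inv_into A \<sigma>"
    have left: "map_prod ?\<tau> ?\<tau> ` map_prod \<sigma> \<sigma> ` p = p" if "p \<subseteq> A \<times> A" for p
      using that inj by (force simp: image_image inv_into_f_f)
    \<comment> \<open>A subset of the relabelled r is the image of some subset p of r. That p is an
      order follows by carrying q back along the inverse bijection.\<close>
    obtain p where p: "p \<subseteq> r" "q = map_prod \<sigma> \<sigma> ` p"
      using q subset_image_iff[of q "map_prod \<sigma> \<sigma>" r] by (auto simp: suborders_def)
    have "partial_order_on A (map_prod ?\<tau> ?\<tau> ` q)"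
      using q by (intro partial_order_on_relabel[OF bij_betw_inv_into[OF assms(1)]])
        (simp add: suborders_def)
    then have "p \<in> suborders A r"
      using left[of p] p assms(2) by (simp add: suborders_def)
    then show "q \<in> (`) (map_prod \<sigma> \<sigma>) ` suborders A r"
      using p(2) by blast
  qed (auto simp: suborders_def intro: partial_order_on_relabel[OF assms(1)])
qed

lemma suborder_sum_natural:
  assumes "bij_betw \<sigma> A B" "X \<in> poset_space A"
  shows "suborder_sum B (poset_act A \<sigma> X) = poset_act A \<sigma> (suborder_sum A X)"
proof (rule flinear_eqI[OF flinear_compose[OF flinear_poset_act flinear_suborder_sum]
      flinear_compose[OF flinear_suborder_sum flinear_poset_act] assms(2)])
  fix r assume "partial_order_on A r"
  note bij = suborders_relabel[OF assms(1) partial_order_onD(4)[OF this]]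
  show "suborder_sum B (poset_act A \<sigma> (basis_vec r)) = poset_act A \<sigma> (suborder_sum A (basis_vec r))"
    by (simp add: flinear_sum[OF flinear_poset_act] sum.reindex_bij_betw[OF bij, symmetric])
qed

section \<open>Compatibility of the suborder sum with the two compositions\<close>

lemma circ_comp_basis [simp]:
  "circ_comp A a B (basis_vec r) (basis_vec s) = (\<Sum>t\<in>Omega A a B r s. basis_vec t)"
  by (simp add: circ_comp_def)

lemma flinear_circ_comp_left: "flinear (\<lambda>X. circ_comp A a B X Y)"
  unfolding circ_comp_def by (rule flinear_bilinear_ext_left)

lemma flinear_circ_comp_right: "flinear (circ_comp A a B X)"
  unfolding circ_comp_def by (rule flinear_bilinear_ext_right)

text \<open>Each comparison in t collapses to one in r. A detour x <= b, b' <= y with b and b' in B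
  collapses to x <= a <= y, and transitivity of r closes it.\<close>

lemma quotient_order_subset:
  assumes "A \<inter> B = {}" "a \<in> A" "partial_order_on A r" "t \<subseteq> bullet_order A a B r s"
  shows "quotient_order (insert_at A a B) t B a \<subseteq> r"
proof -
  have eq: "insert_at A a B - B = A - {a}"
    using assms(1) by (auto simp: insert_at_def)
  have "(a, a) \<in> r"
    using assms(2) partial_order_onD(1)[OF assms(3)] by (simp add: refl_on_def)
  moreover have "(x, a) \<in> r" if "x \<in> A - {a}" "b \<in> B" "(x, b) \<in> t" for x b
    using that assms(1,4) by (auto simp: bullet_order_def)
  moreover have "(a, y) \<in> r" if "y \<in> A - {a}" "b \<in> B" "(b, y) \<in> t" for y b
    using that assms(1,4) by (auto simp: bullet_order_def)
  moreover have "(x, y) \<in> r" if "x \<in> A - {a}" "y \<in> A - {a}" "(x, y) \<in> t" for x y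
    using that assms(1,4) by (auto simp: bullet_order_def)
  moreover have "(x, y) \<in> r" if "(x, a) \<in> r" "(a, y) \<in> r" for x y
    using transD[OF partial_order_onD(2)[OF assms(3)]] that by blast
  ultimately show ?thesis
    unfolding quotient_order_def eq by blast
qed

text \<open>Reflexivity and transitivity pass from t to the quotient. Antisymmetry does not: a point
  outside B between two points of B lies both above and below the collapsed point. It is therefore a
  hypothesis, supplied later by containment in an antisymmetric r.\<close>

lemma partial_order_on_quotient_order:
  assumes "A \<inter> B = {}" "a \<in> A" "partial_order_on (insert_at A a B) t"
    and "antisym (quotient_order (insert_at A a B) t B a)"
  shows "partial_order_on A (quotient_order (insert_at A a B) t B a)"
proof -
  let ?q = "quotient_order (insert_at A a B) t B a"
  have eq: "insert_at A a B - B = A - {a}"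
    using assms(1) by (auto simp: insert_at_def)
  have trans_t: "(x, z) \<in> t" if "(x, y) \<in> t" "(y, z) \<in> t" for x y z
    using transD[OF partial_order_onD(2)[OF assms(3)]] that by blast
  have refl_t: "(x, x) \<in> t" if "x \<in> A - {a}" for x
    using that partial_order_onD(1)[OF assms(3)] by (auto simp: refl_on_def insert_at_def)
  have qa: "(a, y) \<in> ?q \<longleftrightarrow> (\<exists>b\<in>B. (b, y) \<in> t)" if "y \<in> A - {a}" for y
    using that unfolding quotient_order_def eq by auto
  have qaa: "(a, a) \<in> ?q"
    unfolding quotient_order_def by simp
  have qa': "(x, a) \<in> ?q \<longleftrightarrow> (\<exists>b\<in>B. (x, b) \<in> t)" if "x \<in> A - {a}" for x
    using that unfolding quotient_order_def eq by auto
  have q: "(x, y) \<in> ?q \<longleftrightarrow> (x, y) \<in> t \<or> (x, a) \<in> ?q \<and> (a, y) \<in> ?q"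
    if "x \<in> A - {a}" "y \<in> A - {a}" for x y
    using that qa[OF that(2)] qa'[OF that(1)] unfolding quotient_order_def eq by auto
  have sub: "?q \<subseteq> A \<times> A"
    using assms(2) unfolding quotient_order_def eq by auto
  have up: "(a, z) \<in> ?q" if "(a, y) \<in> ?q" "(y, z) \<in> t" "y \<in> A - {a}" "z \<in> A - {a}" for y z
    using that qa trans_t by blast
  have down: "(x, a) \<in> ?q" if "(x, y) \<in> t" "(y, a) \<in> ?q" "x \<in> A - {a}" "y \<in> A - {a}" for x y
    using that qa' trans_t by blast
  \<comment> \<open>Two detours through a merge into one, with x <= a from the first and a <= z from
    the second. A detour next to a step of t is absorbed by \<open>up\<close> or
    \<open>down\<close>.\<close>
  have "(x, z) \<in> ?q" if h: "(x, y) \<in> ?q" "(y, z) \<in> ?q" for x y z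
  proof -
    have "x \<in> A" "y \<in> A" "z \<in> A" using h sub by auto
    then consider "x = a" "z = a" | "x \<in> A - {a}" "z = a" | "x = a" "z \<in> A - {a}"
      | "x \<in> A - {a}" "z \<in> A - {a}" by blast
    moreover have "y = a \<or> y \<in> A - {a}" using \<open>y \<in> A\<close> by blast
    ultimately show ?thesis
      using h qaa q up down trans_t by cases metis+
  qed
  moreover have "(x, x) \<in> ?q" if "x \<in> A" for x
    using that qaa q[of x x] refl_t[of x] by blast
  ultimately show ?thesis
    using sub assms(4)
    unfolding partial_order_on_def preorder_on_def refl_on_def trans_def by blast
qed

lemma partial_order_on_restrict:
  assumes "partial_order_on P t" "B \<subseteq> P"
  shows "partial_order_on B (t \<inter> B \<times> B)"
  using assms unfolding partial_order_on_iff by blast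

text \<open>
  An order \<open>t\<close> determines the pair \<open>(r', s')\<close> with \<open>t \<in> Omega A a B r' s'\<close> as its quotient and
  its restriction, so this union is disjoint.
\<close>

lemma suborders_bullet_order:
  assumes "A \<inter> B = {}" "a \<in> A" "partial_order_on A r" "partial_order_on B s"
  shows "suborders (insert_at A a B) (bullet_order A a B r s) =
    (\<Union>(r', s')\<in>suborders A r \<times> suborders B s. Omega A a B r' s')"
proof (intro equalityI subsetI)
  let ?P = "insert_at A a B"
  have BP: "B \<subseteq> ?P" by (auto simp: insert_at_def)
  fix t assume "t \<in> suborders ?P (bullet_order A a B r s)"
  then have t: "partial_order_on ?P t" "t \<subseteq> bullet_order A a B r s"
    by (auto simp: suborders_def)
  note q = quotient_order_subset[OF assms(1-3) t(2)]
  \<comment> \<open>The quotient is contained in r and inherits antisymmetry from it, which makes it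
    a partial order.\<close>
  have "quotient_order ?P t B a \<in> suborders A r"
    using partial_order_on_quotient_order[OF assms(1,2) t(1)
        antisym_subset[OF q partial_order_onD(3)[OF assms(3)]]] q
    by (simp add: suborders_def)
  moreover have "t \<inter> B \<times> B \<in> suborders B s"
    using partial_order_on_restrict[OF t(1) BP] t(2) assms(1)
    by (auto simp: suborders_def bullet_order_def)
  moreover have "convex_in ?P t B"
    unfolding convex_in_def
  proof (intro conjI ballI impI BP)
    fix x y z assume h: "x \<in> B" "y \<in> B" "z \<in> ?P" "(x, z) \<in> t \<and> (z, y) \<in> t"
    \<comment> \<open>A point outside B between two points of B would satisfy a <= z <= a in r and
      so equal a.\<close>
    show "z \<in> B"
    proof (rule ccontr)
      assume "z \<notin> B"
      then have "(a, z) \<in> r" "(z, a) \<in> r" "z \<noteq> a"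
        using h t(2) assms(1) by (auto simp: bullet_order_def)
      then show False
        using antisymD[OF partial_order_onD(3)[OF assms(3)]] by blast
    qed
  qed
  ultimately show "t \<in> (\<Union>(r', s')\<in>suborders A r \<times> suborders B s. Omega A a B r' s')"
    using t(1) by (auto simp: Omega_def)
next
  let ?P = "insert_at A a B"
  have eq: "?P - B = A - {a}"
    using assms(1) by (auto simp: insert_at_def)
  fix t assume "t \<in> (\<Union>(r', s')\<in>suborders A r \<times> suborders B s. Omega A a B r' s')"
  then have t: "partial_order_on ?P t" and s: "t \<inter> B \<times> B \<subseteq> s"
    and q: "quotient_order ?P t B a \<subseteq> r"
    by (auto simp: Omega_def suborders_def)
  \<comment> \<open>A pair inside B x B is covered by s. Any other pair of t yields a pair of the
    quotient once B is collapsed to a, and hence a pair of r.\<close>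
  have "(x, y) \<in> bullet_order A a B r s" if xy: "(x, y) \<in> t" for x y
  proof -
    have "x \<in> B \<or> x \<in> A - {a}" "y \<in> B \<or> y \<in> A - {a}"
      using xy partial_order_onD(4)[OF t] eq by auto
    moreover have "(x, y) \<in> r" if "x \<in> A - {a}" "y \<in> A - {a}"
      using that xy by (intro subsetD[OF q]) (simp add: quotient_order_def eq)
    moreover have "(x, a) \<in> r" if "x \<in> A - {a}" "y \<in> B"
      using that xy by (intro subsetD[OF q]) (auto simp: quotient_order_def eq)
    moreover have "(a, y) \<in> r" if "x \<in> B" "y \<in> A - {a}"
      using that xy by (intro subsetD[OF q]) (auto simp: quotient_order_def eq)
    ultimately show ?thesis
      using xy s unfolding bullet_order_def by blast
  qed
  then show "t \<in> suborders ?P (bullet_order A a B r s)"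
    using t by (auto simp: suborders_def)
qed

text \<open>On basis vectors the left side sums over the suborders of one bullet composite. Grouping
  them by quotient r' and restriction s' leaves, for each pair (r', s'), exactly the sum that
  defines the circ composite of r' and s'.\<close>

lemma suborder_sum_bullet_comp:
  fixes X Y :: "'a rel \<Rightarrow>\<^sub>0 'k::field"
  assumes fin: "finite A" "finite B" and AB: "A \<inter> B = {}" "a \<in> A"
    and X: "X \<in> poset_space A" and Y: "Y \<in> poset_space B"
  shows "suborder_sum (insert_at A a B) (bullet_comp A a B X Y) =
    circ_comp A a B (suborder_sum A X) (suborder_sum B Y)"
proof (rule flinear_eqI2[OF _ _ _ _ X Y,
      where f = "\<lambda>X Y. suborder_sum (insert_at A a B) (bullet_comp A a B X Y)"
      and g = "\<lambda>X Y. circ_comp A a B (suborder_sum A X) (suborder_sum B Y)"])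
  fix r s assume r: "partial_order_on A r" and s: "partial_order_on B s"
  have finO: "finite (Omega A a B r' s')" for r' s'
    by (rule finite_subset[OF _ finite_partial_orders[of "insert_at A a B"]])
       (use fin in \<open>auto simp: Omega_def insert_at_def\<close>)
  have "suborder_sum (insert_at A a B) (bullet_comp A a B (basis_vec r) (basis_vec s)) =
      (\<Sum>t\<in>(\<Union>p\<in>suborders A r \<times> suborders B s. Omega A a B (fst p) (snd p)). basis_vec t :: 'a rel \<Rightarrow>\<^sub>0 'k)"
    using suborders_bullet_order[OF AB r s] by (simp add: case_prod_beta')
  also have "\<dots> = (\<Sum>p\<in>suborders A r \<times> suborders B s. \<Sum>t\<in>Omega A a B (fst p) (snd p). basis_vec t)"
    by (rule sum.UNION_disjoint)
       (use finO finite_suborders[OF fin(1)] finite_suborders[OF fin(2)] in \<open>auto simp: Omega_def\<close>)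
  also have "\<dots> = (\<Sum>r'\<in>suborders A r. \<Sum>s'\<in>suborders B s. circ_comp A a B (basis_vec r') (basis_vec s'))"
    by (simp add: sum.cartesian_product case_prod_beta')
  also have "\<dots> = circ_comp A a B (suborder_sum A (basis_vec r)) (suborder_sum B (basis_vec s))"
    by (subst sum.swap) (simp only: flinear_sum[OF flinear_circ_comp_left]
        flinear_sum[OF flinear_circ_comp_right] suborder_sum_basis)
  finally show "suborder_sum (insert_at A a B) (bullet_comp A a B (basis_vec r) (basis_vec s)) =
      circ_comp A a B (suborder_sum A (basis_vec r)) (suborder_sum B (basis_vec s) :: 'a rel \<Rightarrow>\<^sub>0 'k)" .
qed (rule flinear_compose[OF flinear_bullet_comp_left flinear_suborder_sum]
    flinear_compose[OF flinear_bullet_comp_right flinear_suborder_sum]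
    flinear_compose[OF flinear_suborder_sum flinear_circ_comp_left]
    flinear_compose[OF flinear_suborder_sum flinear_circ_comp_right])+

lemma suborder_sum_unit: "suborder_sum {a} (poset_unit a) = poset_unit a"
proof -
  have "suborders {a} {(a, a)} = {{(a, a)}}"
  proof (intro equalityI subsetI)
    fix q assume "q \<in> suborders {a} {(a, a)}"
    then have "q \<subseteq> {(a, a)}" "(a, a) \<in> q"
      using partial_order_onD(1)[of "{a}" q] by (auto simp: suborders_def refl_on_def)
    then show "q \<in> {{(a, a)}}" by auto
  qed (simp add: suborders_def partial_order_on_iff)
  then show ?thesis by (simp add: poset_unit_def)
qed

lemma linear_map_on_suborder_sum:
  "linear_map_on fscale fscale (poset_space A) (poset_space A) (suborder_sum A)"
  by (intro linear_map_on_flinear flinear_suborder_sum suborder_sum_in_poset_space)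

lemma linear_operad_circ:
  "linear_operad (fscale :: 'k::field \<Rightarrow> ('a rel \<Rightarrow>\<^sub>0 'k) \<Rightarrow> _)
     poset_space poset_act circ_comp poset_unit"
  by (rule linear_operad_transport[OF linear_operad_bullet linear_species_poset, of suborder_sum])
     (simp_all add: linear_map_on_suborder_sum bij_betw_suborder_sum suborder_sum_natural
       suborder_sum_bullet_comp suborder_sum_unit)

lemma linear_operad_iso_suborder_sum:
  "linear_operad_iso (fscale :: 'k::field \<Rightarrow> ('a rel \<Rightarrow>\<^sub>0 'k) \<Rightarrow> _)
     poset_space poset_act bullet_comp poset_unit
     fscale poset_space poset_act circ_comp poset_unit suborder_sum"
  by (intro linear_operad_iso.intro linear_operad_bullet linear_operad_circ
      linear_operad_iso_axioms.intro)
     (simp_all add: linear_map_on_suborder_sum bij_betw_suborder_sum suborder_sum_natural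
       suborder_sum_bullet_comp suborder_sum_unit)

theorem corollary10:
  shows "linear_operad (fscale :: 'k::field \<Rightarrow> ('a rel \<Rightarrow>\<^sub>0 'k) \<Rightarrow> ('a rel \<Rightarrow>\<^sub>0 'k))
           poset_space poset_act circ_comp poset_unit \<and>
         linear_operad (fscale :: 'k \<Rightarrow> ('a rel \<Rightarrow>\<^sub>0 'k) \<Rightarrow> ('a rel \<Rightarrow>\<^sub>0 'k))
           poset_space poset_act bullet_comp poset_unit \<and>
         (\<exists>\<theta>. linear_operad_iso
           (fscale :: 'k \<Rightarrow> ('a rel \<Rightarrow>\<^sub>0 'k) \<Rightarrow> ('a rel \<Rightarrow>\<^sub>0 'k))
             poset_space poset_act circ_comp poset_unit
           (fscale :: 'k \<Rightarrow> ('a rel \<Rightarrow>\<^sub>0 'k) \<Rightarrow> ('a rel \<Rightarrow>\<^sub>0 'k))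
             poset_space poset_act bullet_comp poset_unit \<theta>)"
proof (intro conjI)
  show "\<exists>\<theta>. linear_operad_iso
      (fscale :: 'k \<Rightarrow> ('a rel \<Rightarrow>\<^sub>0 'k) \<Rightarrow> ('a rel \<Rightarrow>\<^sub>0 'k))
        poset_space poset_act circ_comp poset_unit
      (fscale :: 'k \<Rightarrow> ('a rel \<Rightarrow>\<^sub>0 'k) \<Rightarrow> ('a rel \<Rightarrow>\<^sub>0 'k))
        poset_space poset_act bullet_comp poset_unit \<theta>"
    by (rule exI, rule linear_operad_iso_inverse, rule linear_operad_iso_suborder_sum)
qed (rule linear_operad_circ linear_operad_bullet)+

end
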